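(* Let $f^0(x,y)$ be a curvature surface on $D=\{(x,y)\in\mathbb{R}^2:x>0\}$ with frame field $F^0=[\phi,X^0_\alpha,X^0_\beta,\xi]$. (1) The two curves $y\mapsto f^0(|y|,y)$ ($y>0$ and $y<0$) are envelopes of the family of $y$-curves $y\mapsto f^0(x,y)$ with parameter $x$. (2) The vector $\phi^0:=\phi(x,0)$ does not depend on $x$. The curve $x\mapsto f^0(x,0)$ lies on a $2$-sphere of radius $1/2$ in an affine hyperplane perpendicular to $\phi^0$.
   Context: $X_0(x)=\frac52+\sum_{k\ge1}a_kx^{2k}$ (analytic on $\mathbb{R}$), $a_1=1$, $2(k+1)(4k^2+\frac54)a_{k+1}+(2k-1)a_k=0$ $(k\ge1)$. $h(x,y)=2X_0-xX_0'+y^2\frac{X_0'}{x}+\sqrt5$ (positive). On $D$ put $a_1=\frac{2y}{xh}(X_0+\frac{\sqrt5}{2})$, $b_1=-\frac{1}{xh}(X_0+\frac{\sqrt5}{2}+\sqrt5(x^2-y^2))$, $c_1=-\frac{2}{xh}(X_0+\frac{\sqrt5}{2})$, $a_2=-\frac1h(2X_0+\sqrt5-(x^2+y^2)\frac{X_0'}{x})$, $b_2=-\frac{2y}{h}(\frac{X_0'}{2x}+\sqrt5)$, $c_2=\frac{2y}{h}(X_0''-\frac{X_0'}{x})$. The frame field is an analytic orthonormal frame field $F^0=[\phi,X^0_\alpha,X^0_\beta,\xi]$ of $\mathbb{R}^4$ on $D$ satisfying $\phi_x=-a_1X^0_\alpha$, $\xi_x=b_1X^0_\alpha$, $(X^0_\beta)_x=c_1X^0_\alpha$,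 $(X^0_\alpha)_x=a_1\phi-b_1\xi-c_1X^0_\beta$, $\phi_y=-a_2X^0_\beta$, $\xi_y=b_2X^0_\beta$, $(X^0_\alpha)_y=c_2X^0_\beta$, $(X^0_\beta)_y=a_2\phi-b_2\xi-c_2X^0_\alpha$ (it exists and is unique up to left multiplication by a constant orthogonal matrix). The curvature surface $f^0:D\to\mathbb{R}^4$ determined by $F^0$ is the analytic map, unique up to translation, with $df^0=\frac{x^2-y^2}{xh}X^0_\alpha dx+\frac{2y}{h}X^0_\beta dy$. Envelope: the curve $y\mapsto f^0(|y|,y)$ is an envelope of the family of $y$-curves if, at each of its points $f^0(|y_0|,y_0)$ ($y_0\ne0$), its tangent vector coincides with the tangent vector at $y=y_0$ of the $y$-curve $y\mapsto f^0(|y_0|,y)$ through that point. *)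

theory Defs
  imports "HOL-Analysis.Analysis"
begin

(* The constant term 5/2 is stored as the coefficient with index 0. *)
fun X0_coeff :: "nat \<Rightarrow> real" where
  "X0_coeff 0 = 5 / 2"
| "X0_coeff (Suc 0) = 1"
| "X0_coeff (Suc (Suc k)) =
     - (2 * real (Suc k) - 1) / (2 * (real (Suc k) + 1) * (4 * (real (Suc k))\<^sup>2 + 5 / 4))
       * X0_coeff (Suc k)"

lemma X0_coeff_rec:
  assumes "k \<ge> 1"
  shows "2 * (real k + 1) * (4 * (real k)\<^sup>2 + 5 / 4) * X0_coeff (k + 1)
           + (2 * real k - 1) * X0_coeff k = 0"
proof -
  obtain n where k: "k = Suc n"
    using assms by (cases k) auto
  have "4 * (real k)\<^sup>2 + 5 / 4 > 0"
    by (intro add_nonneg_pos) auto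
  define c where "c = 2 * (real k + 1) * (4 * (real k)\<^sup>2 + 5 / 4)"
  have "c \<noteq> 0"
    using \<open>4 * (real k)\<^sup>2 + 5 / 4 > 0\<close> by (simp add: c_def)
  moreover have "X0_coeff (k + 1) = - (2 * real k - 1) / c * X0_coeff k"
    unfolding k c_def by simp
  ultimately have "c * X0_coeff (k + 1) = - (2 * real k - 1) * X0_coeff k"
    by simp
  then show ?thesis
    unfolding c_def by (simp only: mult_minus_left add.left_inverse)
qed

definition X0 :: "real \<Rightarrow> real" where
  "X0 x = (\<Sum>k. X0_coeff k * x ^ (2 * k))"

(* The series has infinite radius of convergence, so suminf and deriv have their usual meaning. *)
lemma X0_summable: "summable (\<lambda>k. X0_coeff k * x ^ (2 * k))"
proof -
  obtain N where N: "real N > 2 * x\<^sup>2"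
    using reals_Archimedean2 by blast
  show ?thesis
  proof (rule summable_ratio_test)
    show "(1 / 2 :: real) < 1" by simp
  next
    fix n assume n: "Suc N \<le> n"
    then obtain m where m: "n = Suc m" by (cases n) auto
    define r where "r = real n"
    have r: "r \<ge> 1" "r > 2 * x\<^sup>2" using n N by (auto simp: r_def)
    define q where "q = (2 * r - 1) / (2 * (r + 1) * (4 * r\<^sup>2 + 5 / 4))"
    have "(2 * r - 1) * r \<le> 2 * (r + 1) * (4 * r\<^sup>2 + 5 / 4)"
    proof -
      have "(2 * r - 1) * r \<le> 2 * r * r" using r by (simp add: algebra_simps)
      also have "\<dots> \<le> 4 * r\<^sup>2 + 5 / 4" by (simp add: power2_eq_square)
      also have "\<dots> \<le> (2 * (r + 1)) * (4 * r\<^sup>2 + 5 / 4)"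
        using mult_right_mono[of 1 "2 * (r + 1)" "4 * r\<^sup>2 + 5 / 4"] r by simp
      finally show ?thesis .
    qed
    moreover have "2 * (r + 1) * (4 * r\<^sup>2 + 5 / 4) > 0"
      using r by (intro mult_pos_pos add_nonneg_pos) auto
    ultimately have q: "q * r \<le> 1" "q \<ge> 0"
      using r by (auto simp: q_def)
    have "q * (2 * x\<^sup>2) \<le> q * r" using r q by (intro mult_left_mono) auto
    then have qx: "q * x\<^sup>2 \<le> 1 / 2" using q by simp
    have "X0_coeff (Suc n) = - q * X0_coeff n"
      unfolding m q_def r_def by (simp only: X0_coeff.simps minus_divide_left)
    then have "X0_coeff (Suc n) * x ^ (2 * Suc n) = - (q * x\<^sup>2) * (X0_coeff n * x ^ (2 * n))"
      by (simp add: power2_eq_square)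
    then have "norm (X0_coeff (Suc n) * x ^ (2 * Suc n))
        = (q * x\<^sup>2) * norm (X0_coeff n * x ^ (2 * n))"
      using q by (simp add: abs_mult)
    also have "\<dots> \<le> 1 / 2 * norm (X0_coeff n * x ^ (2 * n))"
      using qx by (intro mult_right_mono) auto
    finally show "norm (X0_coeff (Suc n) * x ^ (2 * Suc n))
        \<le> 1 / 2 * norm (X0_coeff n * x ^ (2 * n))" .
  qed
qed

lemma X0_eq: "X0 x = 5 / 2 + (\<Sum>k. X0_coeff (Suc k) * x ^ (2 * Suc k))"
  unfolding X0_def using suminf_split_head[OF X0_summable[of x]] by simp

abbreviation X0' :: "real \<Rightarrow> real" where
  "X0' \<equiv> deriv X0"

abbreviation X0'' :: "real \<Rightarrow> real" where
  "X0'' \<equiv> deriv (deriv X0)"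

definition D :: "(real \<times> real) set" where
  "D = {(x, y). x > 0}"

definition h :: "real \<Rightarrow> real \<Rightarrow> real" where
  "h x y = 2 * X0 x - x * X0' x + y\<^sup>2 * (X0' x / x) + sqrt 5"

definition a1 :: "real \<Rightarrow> real \<Rightarrow> real" where
  "a1 x y = 2 * y / (x * h x y) * (X0 x + sqrt 5 / 2)"

definition b1 :: "real \<Rightarrow> real \<Rightarrow> real" where
  "b1 x y = - (1 / (x * h x y)) * (X0 x + sqrt 5 / 2 + sqrt 5 * (x\<^sup>2 - y\<^sup>2))"

definition c1 :: "real \<Rightarrow> real \<Rightarrow> real" where
  "c1 x y = - (2 / (x * h x y)) * (X0 x + sqrt 5 / 2)"

definition a2 :: "real \<Rightarrow> real \<Rightarrow> real" where
  "a2 x y = - (1 / h x y) * (2 * X0 x + sqrt 5 - (x\<^sup>2 + y\<^sup>2) * (X0' x / x))"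

definition b2 :: "real \<Rightarrow> real \<Rightarrow> real" where
  "b2 x y = - (2 * y / h x y) * (X0' x / (2 * x) + sqrt 5)"

definition c2 :: "real \<Rightarrow> real \<Rightarrow> real" where
  "c2 x y = 2 * y / h x y * (X0'' x - X0' x / x)"

(* The library's analytic_on is complex analyticity in one variable. *)
definition real_analytic_on2 ::
    "(real \<times> real \<Rightarrow> 'a::real_normed_vector) \<Rightarrow> (real \<times> real) set \<Rightarrow> bool" where
  "real_analytic_on2 g S \<longleftrightarrow>
     (\<forall>(x0, y0)\<in>S. \<exists>r>0. \<exists>c :: nat \<Rightarrow> nat \<Rightarrow> 'a.
        \<forall>x y. \<bar>x - x0\<bar> < r \<and> \<bar>y - y0\<bar> < r \<longrightarrow>
          ((\<lambda>(i, j). ((x - x0) ^ i * (y - y0) ^ j) *\<^sub>R c i j) has_sum g (x, y)) UNIV)"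

definition orthonormal_frame :: "real^4 \<Rightarrow> real^4 \<Rightarrow> real^4 \<Rightarrow> real^4 \<Rightarrow> bool" where
  "orthonormal_frame u1 u2 u3 u4 \<longleftrightarrow>
     norm u1 = 1 \<and> norm u2 = 1 \<and> norm u3 = 1 \<and> norm u4 = 1 \<and>
     u1 \<bullet> u2 = 0 \<and> u1 \<bullet> u3 = 0 \<and> u1 \<bullet> u4 = 0 \<and> u2 \<bullet> u3 = 0 \<and> u2 \<bullet> u4 = 0 \<and> u3 \<bullet> u4 = 0"

abbreviation has_x_derivative :: "(real \<times> real \<Rightarrow> real^4) \<Rightarrow> real^4 \<Rightarrow> real \<times> real \<Rightarrow> bool" where
  "has_x_derivative g v p \<equiv> ((\<lambda>s. g (s, snd p)) has_vector_derivative v) (at (fst p))"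

abbreviation has_y_derivative :: "(real \<times> real \<Rightarrow> real^4) \<Rightarrow> real^4 \<Rightarrow> real \<times> real \<Rightarrow> bool" where
  "has_y_derivative g v p \<equiv> ((\<lambda>t. g (fst p, t)) has_vector_derivative v) (at (snd p))"

definition frame_field ::
    "(real \<times> real \<Rightarrow> real^4) \<Rightarrow> (real \<times> real \<Rightarrow> real^4) \<Rightarrow>
     (real \<times> real \<Rightarrow> real^4) \<Rightarrow> (real \<times> real \<Rightarrow> real^4) \<Rightarrow> bool" where
  "frame_field \<phi> X\<^sub>\<alpha> X\<^sub>\<beta> \<xi> \<longleftrightarrow>
     real_analytic_on2 \<phi> D \<and> real_analytic_on2 X\<^sub>\<alpha> D \<and>
     real_analytic_on2 X\<^sub>\<beta> D \<and> real_analytic_on2 \<xi> D \<and>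
     (\<forall>p\<in>D. orthonormal_frame (\<phi> p) (X\<^sub>\<alpha> p) (X\<^sub>\<beta> p) (\<xi> p)) \<and>
     (\<forall>(x, y)\<in>D.
        has_x_derivative \<phi> (- a1 x y *\<^sub>R X\<^sub>\<alpha> (x, y)) (x, y) \<and>
        has_x_derivative \<xi> (b1 x y *\<^sub>R X\<^sub>\<alpha> (x, y)) (x, y) \<and>
        has_x_derivative X\<^sub>\<beta> (c1 x y *\<^sub>R X\<^sub>\<alpha> (x, y)) (x, y) \<and>
        has_x_derivative X\<^sub>\<alpha>
          (a1 x y *\<^sub>R \<phi> (x, y) - b1 x y *\<^sub>R \<xi> (x, y) - c1 x y *\<^sub>R X\<^sub>\<beta> (x, y)) (x, y) \<and>
        has_y_derivative \<phi> (- a2 x y *\<^sub>R X\<^sub>\<beta> (x, y)) (x, y) \<and>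
        has_y_derivative \<xi> (b2 x y *\<^sub>R X\<^sub>\<beta> (x, y)) (x, y) \<and>
        has_y_derivative X\<^sub>\<alpha> (c2 x y *\<^sub>R X\<^sub>\<beta> (x, y)) (x, y) \<and>
        has_y_derivative X\<^sub>\<beta>
          (a2 x y *\<^sub>R \<phi> (x, y) - b2 x y *\<^sub>R \<xi> (x, y) - c2 x y *\<^sub>R X\<^sub>\<alpha> (x, y)) (x, y))"

definition curvature_surface ::
    "(real \<times> real \<Rightarrow> real^4) \<Rightarrow> (real \<times> real \<Rightarrow> real^4) \<Rightarrow> (real \<times> real \<Rightarrow> real^4) \<Rightarrow>
     (real \<times> real \<Rightarrow> real^4) \<Rightarrow> (real \<times> real \<Rightarrow> real^4) \<Rightarrow> bool" where
  "curvature_surface f \<phi> X\<^sub>\<alpha> X\<^sub>\<beta> \<xi> \<longleftrightarrow>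
     frame_field \<phi> X\<^sub>\<alpha> X\<^sub>\<beta> \<xi> \<and> real_analytic_on2 f D \<and>
     (\<forall>(x, y)\<in>D. (f has_derivative
        (\<lambda>(dx, dy). ((x\<^sup>2 - y\<^sup>2) / (x * h x y) * dx) *\<^sub>R X\<^sub>\<alpha> (x, y) +
                    (2 * y / h x y * dy) *\<^sub>R X\<^sub>\<beta> (x, y))) (at (x, y)))"

definition envelope_of_y_curves ::
    "(real \<times> real \<Rightarrow> real^4) \<Rightarrow> (real \<Rightarrow> real) \<Rightarrow> real set \<Rightarrow> bool" where
  "envelope_of_y_curves f \<gamma> I \<longleftrightarrow>
     (\<forall>y0\<in>I. \<exists>v. ((\<lambda>y. f (\<gamma> y, y)) has_vector_derivative v) (at y0) \<and>
                 ((\<lambda>y. f (\<gamma> y0, y)) has_vector_derivative v) (at y0))"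

end

theory Submission
  imports Defs
begin

text \<open>
  For (1), the coefficient of \<open>dx\<close> in \<open>df\<close> contains the factor \<open>x\<^sup>2 - y\<^sup>2\<close>, so along
  \<open>x = \<bar>y\<bar>\<close> only the \<open>y\<close>-direction contributes to the velocity.
  For (2), \<open>a\<^sub>1 = 0\<close> on \<open>y = 0\<close>, so \<open>\<phi>\<close> and hence \<open>\<phi> \<bullet> f\<close> are constant there, and the linear
  relation \<open>x\<^sup>2 / (x h) + b\<^sub>1 / \<surd>5 - c\<^sub>1 / (2 \<surd>5) = 0\<close> on \<open>y = 0\<close> makes
  \<open>f + \<xi> / \<surd>5 - X\<^sub>\<beta> / (2 \<surd>5)\<close> constant: this is the center, and the squared radius is
  \<open>1/5 + 1/20 = 1/4\<close>.
\<close>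

lemma has_vector_derivative_zero_constant_pos:
  fixes g :: "real \<Rightarrow> 'a::real_normed_vector"
  assumes "\<And>x. x > 0 \<Longrightarrow> (g has_vector_derivative 0) (at x)"
  obtains c where "\<And>x. x > 0 \<Longrightarrow> g x = c"
  using has_vector_derivative_zero_constant[of "{0<..}" g] assms
  by (metis convex_real_interval(3) greaterThan_iff has_vector_derivative_at_within)

text \<open>Chain rule for \<open>f\<close> along a plane curve \<open>g\<close> with velocity
  \<open>(u, v)\<close>. It serves three curves: the pair \<open>(\<bar>y\<bar>, y)\<close> and
  \<open>(\<bar>y0\<bar>, y)\<close> for the envelopes, and \<open>(s, 0)\<close> for the spherical
  curve.\<close>

lemma curvature_surface_has_vector_derivative:
  assumes "curvature_surface f \<phi> X\<^sub>\<alpha> X\<^sub>\<beta> \<xi>" "fst (g t) > 0"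
    and g: "(g has_vector_derivative (u, v)) (at t)"
    and "g t = (x, y)"
  shows "((\<lambda>t. f (g t)) has_vector_derivative
           ((x\<^sup>2 - y\<^sup>2) / (x * h x y) * u) *\<^sub>R X\<^sub>\<alpha> (x, y) + (2 * y / h x y * v) *\<^sub>R X\<^sub>\<beta> (x, y)) (at t)"
proof -
  have "(f has_derivative
        (\<lambda>(dx, dy). ((x\<^sup>2 - y\<^sup>2) / (x * h x y) * dx) *\<^sub>R X\<^sub>\<alpha> (x, y) +
                    (2 * y / h x y * dy) *\<^sub>R X\<^sub>\<beta> (x, y))) (at (g t))"
    using assms by (auto simp: curvature_surface_def D_def)
  from vector_derivative_diff_chain_within[OF g has_derivative_at_withinI[OF this]]
  show ?thesis
    by (simp add: o_def)
qed

lemma envelope_of_y_curves_abs: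
  assumes "curvature_surface f \<phi> X\<^sub>\<alpha> X\<^sub>\<beta> \<xi>" "0 \<notin> I"
  shows "envelope_of_y_curves f (\<lambda>y. \<bar>y\<bar>) I"
  unfolding envelope_of_y_curves_def
proof (intro ballI exI conjI)
  fix y0 assume "y0 \<in> I"
  then have y0: "y0 \<noteq> 0" using assms by auto
  \<comment> \<open>The absolute value is the norm on the reals, differentiable away from 0. The
    slope \<open>sgn y0\<close> drops out below, where it is multiplied by
    \<open>\<bar>y0\<bar>\<^sup>2 - y0\<^sup>2 = 0\<close>.\<close>
  have "((\<lambda>y. \<bar>y\<bar>) has_vector_derivative sgn y0) (at y0)"
    using has_derivative_norm[OF y0] by (simp add: has_vector_derivative_def real_norm_def[abs_def])
  then have 1: "((\<lambda>y. (\<bar>y\<bar>, y)) has_vector_derivative (sgn y0, 1)) (at y0)"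
    by (intro has_vector_derivative_Pair) (auto intro!: derivative_eq_intros)
  show "((\<lambda>y. f (\<bar>y\<bar>, y)) has_vector_derivative (2 * y0 / h \<bar>y0\<bar> y0) *\<^sub>R X\<^sub>\<beta> (\<bar>y0\<bar>, y0)) (at y0)"
    using curvature_surface_has_vector_derivative[OF assms(1) _ 1 refl] y0 by simp
  have 2: "((\<lambda>y. (\<bar>y0\<bar>, y)) has_vector_derivative (0, 1)) (at y0)"
    by (intro has_vector_derivative_Pair) (auto intro!: derivative_eq_intros)
  show "((\<lambda>y. f (\<bar>y0\<bar>, y)) has_vector_derivative (2 * y0 / h \<bar>y0\<bar> y0) *\<^sub>R X\<^sub>\<beta> (\<bar>y0\<bar>, y0)) (at y0)"
    using curvature_surface_has_vector_derivative[OF assms(1) _ 2 refl] y0 by simp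
qed

text \<open>Over the common denominator \<open>x * h x 0\<close>, the two terms with
  \<open>X0 x + sqrt 5 / 2\<close> cancel, and \<open>x\<^sup>2\<close> cancels the rest of
  \<open>b1\<close>.\<close>

lemma center_relation:
  assumes "x > 0"
  shows "x\<^sup>2 / (x * h x 0) + b1 x 0 / sqrt 5 - c1 x 0 / (2 * sqrt 5) = 0"
proof -
  have "x\<^sup>2 / (x * h x 0) + b1 x 0 / sqrt 5 - c1 x 0 / (2 * sqrt 5)
      = (x\<^sup>2 - (X0 x + sqrt 5 / 2 + sqrt 5 * x\<^sup>2) / sqrt 5 + (X0 x + sqrt 5 / 2) / sqrt 5)
          / (x * h x 0)"
    by (simp add: b1_def c1_def add_divide_distrib diff_divide_distrib mult.commute)
  also have "\<dots> = 0"
    by (simp add: add_divide_distrib)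
  finally show ?thesis .
qed

text \<open>Pythagoras for two orthonormal vectors. It gives the radius, with \<open>\<xi>\<close>
  and \<open>X\<^sub>\<beta>\<close> in the roles of \<open>u4\<close> and
  \<open>u3\<close>.\<close>

lemma norm_center_offset:
  assumes "orthonormal_frame u1 u2 u3 u4"
  shows "norm ((1 / sqrt 5) *\<^sub>R u4 - (1 / (2 * sqrt 5)) *\<^sub>R u3) = 1 / 2"
proof -
  have "u3 \<bullet> u3 = 1" "u4 \<bullet> u4 = 1" "u3 \<bullet> u4 = 0" "u4 \<bullet> u3 = 0"
    using assms by (auto simp: orthonormal_frame_def norm_eq_1 inner_commute)
  then have "(norm ((1 / sqrt 5) *\<^sub>R u4 - (1 / (2 * sqrt 5)) *\<^sub>R u3))\<^sup>2 = (1 / 2)\<^sup>2"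
    unfolding power2_norm_eq_inner
    by (simp add: inner_diff_left inner_diff_right field_simps power2_eq_square)
  then show ?thesis
    by (rule power2_eq_imp_eq) auto
qed

theorem corollary3p9:
  fixes f \<phi> X\<^sub>\<alpha> X\<^sub>\<beta> \<xi> :: "real \<times> real \<Rightarrow> real^4"
  assumes "curvature_surface f \<phi> X\<^sub>\<alpha> X\<^sub>\<beta> \<xi>"
  shows "(envelope_of_y_curves f (\<lambda>y. \<bar>y\<bar>) {0<..} \<and>
          envelope_of_y_curves f (\<lambda>y. \<bar>y\<bar>) {..<0}) \<and>
         (\<exists>\<phi>0. (\<forall>x>0. \<phi> (x, 0) = \<phi>0) \<and> \<phi>0 \<noteq> 0 \<and>
            (\<exists>c d. \<phi>0 \<bullet> c = d \<and>
               (\<forall>x>0. f (x, 0) \<in> sphere c (1 / 2) \<inter> {p. \<phi>0 \<bullet> p = d})))"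
proof -
  have orth: "orthonormal_frame (\<phi> (x, 0)) (X\<^sub>\<alpha> (x, 0)) (X\<^sub>\<beta> (x, 0)) (\<xi> (x, 0))" if "x > 0" for x
    using assms that by (auto simp: curvature_surface_def frame_field_def D_def)
  have deriv: "((\<lambda>s. \<phi> (s, 0)) has_vector_derivative 0) (at x)"
    "((\<lambda>s. \<xi> (s, 0)) has_vector_derivative b1 x 0 *\<^sub>R X\<^sub>\<alpha> (x, 0)) (at x)"
    "((\<lambda>s. X\<^sub>\<beta> (s, 0)) has_vector_derivative c1 x 0 *\<^sub>R X\<^sub>\<alpha> (x, 0)) (at x)"
    if "x > 0" for x
  proof -
    have "a1 x 0 = 0"
      by (simp add: a1_def)
    moreover have "(x, 0) \<in> D"
      using that by (simp add: D_def)
    ultimately show "((\<lambda>s. \<phi> (s, 0)) has_vector_derivative 0) (at x)"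
      "((\<lambda>s. \<xi> (s, 0)) has_vector_derivative b1 x 0 *\<^sub>R X\<^sub>\<alpha> (x, 0)) (at x)"
      "((\<lambda>s. X\<^sub>\<beta> (s, 0)) has_vector_derivative c1 x 0 *\<^sub>R X\<^sub>\<alpha> (x, 0)) (at x)"
      using assms by (fastforce simp: curvature_surface_def frame_field_def)+
  qed
  have derivf: "((\<lambda>s. f (s, 0)) has_vector_derivative (x\<^sup>2 / (x * h x 0)) *\<^sub>R X\<^sub>\<alpha> (x, 0)) (at x)"
    if "x > 0" for x
  proof -
    have "((\<lambda>s. (s, 0::real)) has_vector_derivative (1, 0)) (at x)"
      by (intro has_vector_derivative_Pair) (auto intro!: derivative_eq_intros)
    from curvature_surface_has_vector_derivative[OF assms _ this refl] that show ?thesis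
      by simp
  qed
  obtain \<phi>0 where \<phi>0: "\<And>x. x > 0 \<Longrightarrow> \<phi> (x, 0) = \<phi>0"
    using has_vector_derivative_zero_constant_pos[OF deriv(1)] by metis
  \<comment> \<open>The candidate for the center, seen from the point with parameter
    \<open>s\<close>.\<close>
  define g where
    "g = (\<lambda>s. f (s, 0) + ((1 / sqrt 5) *\<^sub>R \<xi> (s, 0) - (1 / (2 * sqrt 5)) *\<^sub>R X\<^sub>\<beta> (s, 0)))"
  have "(g has_vector_derivative 0) (at x)" if "x > 0" for x
  proof -
    have "(g has_vector_derivative (x\<^sup>2 / (x * h x 0)) *\<^sub>R X\<^sub>\<alpha> (x, 0) +
        ((1 / sqrt 5) *\<^sub>R b1 x 0 *\<^sub>R X\<^sub>\<alpha> (x, 0) - (1 / (2 * sqrt 5)) *\<^sub>R c1 x 0 *\<^sub>R X\<^sub>\<alpha> (x, 0))) (at x)"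
      unfolding g_def
      by (intro has_vector_derivative_add has_vector_derivative_diff derivf deriv that
          bounded_linear.has_vector_derivative[OF bounded_linear_scaleR_right])
    \<comment> \<open>All three derivatives are multiples of \<open>X\<^sub>\<alpha>\<close>, so one
      scalar relation decides whether they cancel.\<close>
    also have "(x\<^sup>2 / (x * h x 0)) *\<^sub>R X\<^sub>\<alpha> (x, 0) +
        ((1 / sqrt 5) *\<^sub>R b1 x 0 *\<^sub>R X\<^sub>\<alpha> (x, 0) - (1 / (2 * sqrt 5)) *\<^sub>R c1 x 0 *\<^sub>R X\<^sub>\<alpha> (x, 0))
      = (x\<^sup>2 / (x * h x 0) + b1 x 0 / sqrt 5 - c1 x 0 / (2 * sqrt 5)) *\<^sub>R X\<^sub>\<alpha> (x, 0)"
      by (simp add: scaleR_add_left scaleR_diff_left)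
    finally show ?thesis
      using center_relation[OF that] by simp
  qed
  then obtain c where c: "\<And>x. x > 0 \<Longrightarrow> g x = c"
    using has_vector_derivative_zero_constant_pos by metis
  have "\<phi>0 \<noteq> 0"
    using orth[of 1] \<phi>0[of 1] by (auto simp: orthonormal_frame_def)
  \<comment> \<open>The offset from \<open>f\<close> to \<open>c\<close> is spanned by
    \<open>\<xi>\<close> and \<open>X\<^sub>\<beta>\<close>, both orthogonal to
    \<open>\<phi>0\<close>. Hence the hyperplane can be taken through \<open>c\<close>, where it
    cuts the 3-sphere in a great 2-sphere, again of radius 1/2.\<close>
  moreover have "f (x, 0) \<in> sphere c (1 / 2) \<inter> {p. \<phi>0 \<bullet> p = \<phi>0 \<bullet> c}" if "x > 0" for x
  proof -
    have "dist c (f (x, 0)) = 1 / 2"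
      using norm_center_offset[OF orth[OF that]] c[OF that] by (auto simp: g_def dist_norm)
    moreover have "\<phi>0 \<bullet> f (x, 0) = \<phi>0 \<bullet> c"
      using orth[OF that] \<phi>0[OF that] c[OF that, symmetric]
      by (simp add: g_def orthonormal_frame_def inner_add_right inner_diff_right)
    ultimately show ?thesis
      by simp
  qed
  ultimately show ?thesis
    using \<phi>0 envelope_of_y_curves_abs[OF assms] by auto
qed

end
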